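(* Let $\mathcal{T}=(t_{ijkl})\in\widehat{\mathcal{E}}_{4,3}$ and suppose that $t_{iiij}t_{ijjj}=0$ but $t_{iiij}+t_{ijjj}\neq 0$ for all $i,j\in\{1,2,3\}$ with $i\neq j$. Then $\mathcal{T}$ is positive definite if and only if $t_{iijj}=1$ for all $i,j\in\{1,2,3\}$ with $i\neq j$, and there is a permutation $(i,j,k)$ of $(1,2,3)$ for which one of the following conditions is satisfied. (a) $t_{1123}=t_{1223}=t_{1233}=0$, $t_{iiij}=t_{jjjk}=t_{ikkk}=0$ and $t_{ijjj},t_{jkkk},t_{iiik}\in\{1,-1\}$. (b) $t_{iiij}=t_{jjjk}=t_{iiik}=0$, and either - $t_{iijk}=t_{ijjk}=0$ and $t_{ijkk}t_{ijjj}=t_{ijjj}t_{jkkk}t_{ikkk}\in\{1,-1\}$, or - $t_{ijjj}t_{jkkk}t_{ikkk}=-t_{iijk}t_{jkkk}=-t_{ijjk}t_{ikkk}=1$ and $t_{ijkk}=0$.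
   Context: A 4th order 3-dimensional real tensor $\mathcal{T}=(t_{ijkl})_{i,j,k,l\in\{1,2,3\}}$ is symmetric if its entries are invariant under all permutations of the four indices (so, e.g., $t_{ijjk}$ denotes the common value of all entries whose index multiset is $\{i,j,j,k\}$). $\widehat{\mathcal{E}}_{4,3}$ is the set of symmetric 4th order 3-dimensional tensors all of whose entries lie in $\{-1,0,1\}$ and whose diagonal entries satisfy $t_{1111}=t_{2222}=t_{3333}=1$. For $x\in\mathbb{R}^3$ put $\mathcal{T}x^4=\sum_{i,j,k,l=1}^3 t_{ijkl}x_ix_jx_kx_l$. $\mathcal{T}$ is positive definite if $\mathcal{T}x^4>0$ for all $x\in\mathbb{R}^3\setminus\{0\}$. *)

theory Defs
  imports "HOL-Analysis.Analysis" "HOL-Combinatorics.Permutations" "HOL-Library.Multiset"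
begin

text \<open>
  A real 4th order tensor is a function of four indices drawn from a finite type. For dimension 3
  the index type is \<open>3\<close>, whose three elements are \<open>1\<close>, \<open>2\<close> and \<open>3\<close> (where \<open>3 = 0\<close>).
\<close>

type_synonym 'n tensor4 = "'n \<Rightarrow> 'n \<Rightarrow> 'n \<Rightarrow> 'n \<Rightarrow> real"

definition symmetric_tensor4 :: "'n tensor4 \<Rightarrow> bool" where
  "symmetric_tensor4 T \<longleftrightarrow>
     (\<forall>\<sigma> (f :: nat \<Rightarrow> 'n). \<sigma> permutes {1..4} \<longrightarrow>
        T (f (\<sigma> 1)) (f (\<sigma> 2)) (f (\<sigma> 3)) (f (\<sigma> 4)) = T (f 1) (f 2) (f 3) (f 4))"

definition tensor4_form :: "('n::finite) tensor4 \<Rightarrow> real ^ 'n \<Rightarrow> real" where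
  "tensor4_form T x = (\<Sum>i\<in>UNIV. \<Sum>j\<in>UNIV. \<Sum>k\<in>UNIV. \<Sum>l\<in>UNIV. T i j k l * x $ i * x $ j * x $ k * x $ l)"

definition positive_definite_tensor4 :: "('n::finite) tensor4 \<Rightarrow> bool" where
  "positive_definite_tensor4 T \<longleftrightarrow> (\<forall>x. x \<noteq> 0 \<longrightarrow> tensor4_form T x > 0)"

definition E_hat_4_3 :: "3 tensor4 set" where
  "E_hat_4_3 = {T. symmetric_tensor4 T \<and> (\<forall>i j k l. T i j k l \<in> {-1, 0, 1}) \<and>
                   T 1 1 1 1 = 1 \<and> T 2 2 2 2 = 1 \<and> T 3 3 3 3 = 1}"

end

theory Submission
  imports Defs
begin

text \<open>
  Evaluating the form at \<open>e\<^sub>i \<plusminus> e\<^sub>j\<close> forces \<open>t\<^sub>i\<^sub>i\<^sub>j\<^sub>j = 1\<close>. Reading \<open>t\<^sub>i\<^sub>i\<^sub>i\<^sub>j = 0\<close> as an arrow from \<open>i\<close> to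
  \<open>j\<close> gives a tournament on three vertices, hence a labelling with \<open>t\<^sub>i\<^sub>i\<^sub>i\<^sub>j = t\<^sub>j\<^sub>j\<^sub>j\<^sub>k = 0\<close> that is either
  transitive (\<open>t\<^sub>i\<^sub>i\<^sub>i\<^sub>k = 0\<close>) or cyclic (\<open>t\<^sub>i\<^sub>k\<^sub>k\<^sub>k = 0\<close>). Sign changes of the variables normalise two of
  the three remaining cubic coefficients to \<open>1\<close>; then a few integer points exclude all values of
  \<open>(t\<^sub>i\<^sub>i\<^sub>j\<^sub>k, t\<^sub>i\<^sub>j\<^sub>j\<^sub>k, t\<^sub>i\<^sub>j\<^sub>k\<^sub>k)\<close> except those listed, for which the form is an explicit sum of squares.
\<close>

section \<open>Ternary quartics\<close>

text \<open>The tensor form in the coordinates \<open>x\<close>, \<open>y\<close>, \<open>z\<close>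
  belonging to indices i, j, k when t_iiij = t_jjjk = t_iiik = 0 and the square coefficients are 1.
  The parameters \<open>p\<close>, \<open>q\<close>, \<open>r\<close> are t_ijjj, t_jkkk, t_ikkk,
  and \<open>a\<close>, \<open>b\<close>, \<open>c\<close> are t_iijk, t_ijjk, t_ijkk.\<close>

definition transitive_quartic ::
    "real \<Rightarrow> real \<Rightarrow> real \<Rightarrow> real \<Rightarrow> real \<Rightarrow> real \<Rightarrow> real \<Rightarrow> real \<Rightarrow> real \<Rightarrow> real" where
  "transitive_quartic p q r a b c x y z =
     x^4 + y^4 + z^4 + 4 * (p * x * y^3 + q * y * z^3 + r * x * z^3)
     + 6 * (x^2 * y^2 + x^2 * z^2 + y^2 * z^2)
     + 12 * (a * x^2 * y * z + b * x * y^2 * z + c * x * y * z^2)"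

text \<open>Here \<open>r\<close> is t_iiik instead, so rotating the variables permutes the three
  cubic monomials.\<close>

definition cyclic_quartic ::
    "real \<Rightarrow> real \<Rightarrow> real \<Rightarrow> real \<Rightarrow> real \<Rightarrow> real \<Rightarrow> real \<Rightarrow> real \<Rightarrow> real \<Rightarrow> real" where
  "cyclic_quartic p q r a b c x y z =
     x^4 + y^4 + z^4 + 4 * (p * x * y^3 + q * y * z^3 + r * x^3 * z)
     + 6 * (x^2 * y^2 + x^2 * z^2 + y^2 * z^2)
     + 12 * (a * x^2 * y * z + b * x * y^2 * z + c * x * y * z^2)"

definition positive_definite3 :: "(real \<Rightarrow> real \<Rightarrow> real \<Rightarrow> real) \<Rightarrow> bool" where
  "positive_definite3 f \<longleftrightarrow> (\<forall>x y z. x \<noteq> 0 \<or> y \<noteq> 0 \<or> z \<noteq> 0 \<longrightarrow> f x y z > 0)"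

lemma positive_definite3D:
  "positive_definite3 f \<Longrightarrow> x \<noteq> 0 \<or> y \<noteq> 0 \<or> z \<noteq> 0 \<Longrightarrow> f x y z > 0"
  by (simp add: positive_definite3_def)

text \<open>Two factors cover all sign changes, because a quartic form is even.\<close>

lemma positive_definite3_rescale:
  assumes "p \<noteq> 0" "q \<noteq> 0" "\<And>x y z. f x (p * y) (q * z) = g x y z"
  shows "positive_definite3 f \<longleftrightarrow> positive_definite3 g"
proof
  assume "positive_definite3 f"
  then show "positive_definite3 g"
    using assms unfolding positive_definite3_def by (metis mult_eq_0_iff)
next
  assume g: "positive_definite3 g"
  have "f x y z = g x (y / p) (z / q)" for x y z
    using assms(3)[of x "y / p" "z / q"] assms(1,2) by simp
  with g show "positive_definite3 f"
    using assms(1,2) unfolding positive_definite3_def by (metis divide_eq_0_iff)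
qed

text \<open>The factor of \<open>y\<close> absorbs the sign \<open>p\<close>, then that of
  \<open>z\<close> absorbs \<open>q\<close>. The product \<open>p * q * r\<close> is what sign
  changes cannot remove, hence its appearance in the final conditions.\<close>

lemma transitive_quartic_normalise:
  assumes "p \<in> {1, -1}" "q \<in> {1, -1}"
  shows "positive_definite3 (transitive_quartic p q r a b c) \<longleftrightarrow>
         positive_definite3 (transitive_quartic 1 1 (p * q * r) (a * q) (b * p * q) (c * p))"
  by (rule positive_definite3_rescale[where p = p and q = "p * q"])
     (use assms in \<open>auto simp: transitive_quartic_def algebra_simps\<close>)

lemma cyclic_quartic_normalise:
  assumes "p \<in> {1, -1}" "q \<in> {1, -1}"
  shows "positive_definite3 (cyclic_quartic p q r a b c) \<longleftrightarrow>
         positive_definite3 (cyclic_quartic 1 1 (p * q * r) (a * q) (b * p * q) (c * p))"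
  by (rule positive_definite3_rescale[where p = p and q = "p * q"])
     (use assms in \<open>auto simp: cyclic_quartic_def algebra_simps\<close>)

section \<open>Necessary conditions from integer points\<close>

lemma transitive_quartic_1_1_coeffs:
  assumes "positive_definite3 (transitive_quartic 1 1 r a b c)"
    and "r \<in> {1, -1}" "a \<in> {-1, 0, 1}" "b \<in> {-1, 0, 1}" "c \<in> {-1, 0, 1}"
  shows "a = 0 \<and> b = 0 \<and> c = r \<or> r = 1 \<and> a = -1 \<and> b = -1 \<and> c = 0"
proof -
  note pos = positive_definite3D[OF assms(1), unfolded transitive_quartic_def]
  \<comment> \<open>For \<open>r = 1\<close> the point (1,1,-4) leaves \<open>c = 1\<close> or the
    exceptional triple (-1,-1,0). For \<open>r = -1\<close> the point (1,-1,4) leaves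
    \<open>c = -1\<close> or the triple (-1,1,0), which (2,-4,-1) excludes. Once
    \<open>c = r\<close>, the other four points force \<open>a = b = 0\<close>.\<close>
  show ?thesis
    using pos[of 1 1 "-4", simplified] pos[of 1 "-1" 4, simplified] pos[of 2 2 3, simplified] pos[of 2 2 "-3", simplified] pos[of 1 "-2" 1, simplified]
      pos[of 2 "-4" "-1", simplified] assms(2-)
    by (simp only: insert_iff empty_iff) (elim disjE; simp)
qed

lemma cyclic_quartic_1_1_coeffs:
  assumes "positive_definite3 (cyclic_quartic 1 1 r a b c)"
    and "r \<in> {1, -1}" "a \<in> {-1, 0, 1}" "b \<in> {-1, 0, 1}" "c \<in> {-1, 0, 1}"
  shows "a = 0 \<and> b = 0 \<and> c = 0"
proof -
  note pos = positive_definite3D[OF assms(1), unfolded cyclic_quartic_def]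
  \<comment> \<open>For \<open>r = 1\<close> the points (2,-4,1), (1,2,-4), (4,-1,-2) are rotations
    of one another up to sign. They show that one coefficient -1 makes all three -1, which (1,1,1)
    excludes, and that exactly two coefficients 1 with a 0 are impossible; (2,1,-1), (1,-3,-1),
    (1,-2,3) exclude the remaining nonzero triples. The points (3,1,1) and (3,-1,2) serve
    \<open>r = -1\<close>, where they restrict \<open>a = -1\<close> and
    \<open>a = 1\<close>.\<close>
  show ?thesis
    using pos[of 2 "-4" 1, simplified] pos[of 1 2 "-4", simplified] pos[of 1 "-3" "-1", simplified] pos[of 2 1 "-1", simplified] pos[of 4 "-1" "-2", simplified]
      pos[of 1 1 1, simplified] pos[of 3 1 1, simplified] pos[of 1 "-2" 3, simplified] pos[of 3 "-1" 2, simplified] assms(2-)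
    by (simp only: insert_iff empty_iff) (elim disjE; simp)
qed

section \<open>Sums of squares for the admissible coefficients\<close>

lemma sq_mult_sum_squares_nonneg: "0 \<le> y\<^sup>2 * ((y + 2 * w)\<^sup>2 + 2 * w\<^sup>2)" for y w :: real
  by simp

text \<open>The bracket vanishes only if \<open>w = 0\<close> and \<open>y = 0\<close>. Expanded,
  the product is y^4 + 4wy^3 + 6w^2y^2: a fourth power with its cubic and square terms.\<close>

lemma sq_mult_sum_squares_pos: "y \<noteq> 0 \<Longrightarrow> 0 < y\<^sup>2 * ((y + 2 * w)\<^sup>2 + 2 * w\<^sup>2)" for y w :: real
  by (cases "w = 0") (simp_all add: add_nonneg_pos)

lemma cyclic_quartic_pos_def:
  assumes "p \<in> {1, -1}" "q \<in> {1, -1}" "r \<in> {1, -1}"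
  shows "positive_definite3 (cyclic_quartic p q r 0 0 0)"
proof -
  \<comment> \<open>Each variable heads one block, so any nonzero variable makes its block
    positive.\<close>
  have eq: "cyclic_quartic p q r 0 0 0 x y z =
      y\<^sup>2 * ((y + 2 * (p * x))\<^sup>2 + 2 * (p * x)\<^sup>2) + z\<^sup>2 * ((z + 2 * (q * y))\<^sup>2 + 2 * (q * y)\<^sup>2)
      + x\<^sup>2 * ((x + 2 * (r * z))\<^sup>2 + 2 * (r * z)\<^sup>2)" for x y z
    using assms unfolding cyclic_quartic_def
    by (auto simp: algebra_simps power2_eq_square power3_eq_cube power4_eq_xxxx)
  show ?thesis
    unfolding positive_definite3_def eq
    by (smt (verit) sq_mult_sum_squares_nonneg sq_mult_sum_squares_pos)
qed

lemma transitive_quartic_pos_def_1: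
  assumes "p \<in> {1, -1}" "q \<in> {1, -1}" "r \<in> {1, -1}"
  shows "positive_definite3 (transitive_quartic p q r 0 0 (q * r))"
proof -
  \<comment> \<open>All terms containing \<open>z\<close> form a single block with w = qy + rx; the
    value \<open>c = q * r\<close> is exactly the cross term of 6w^2z^2.\<close>
  have eq: "transitive_quartic p q r 0 0 (q * r) x y z =
      x^4 + y\<^sup>2 * ((y + 2 * (p * x))\<^sup>2 + 2 * (p * x)\<^sup>2)
      + z\<^sup>2 * ((z + 2 * (q * y + r * x))\<^sup>2 + 2 * (q * y + r * x)\<^sup>2)" for x y z
    using assms unfolding transitive_quartic_def
    by (auto simp: algebra_simps power2_eq_square power3_eq_cube power4_eq_xxxx)
  have "0 \<le> x^4" "x \<noteq> 0 \<Longrightarrow> 0 < x^4" for x :: real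
    by simp_all
  then show ?thesis
    unfolding positive_definite3_def eq
    by (smt (verit) sq_mult_sum_squares_nonneg sq_mult_sum_squares_pos)
qed

text \<open>This is the exceptional triple. The certificate gets its strictness from the term 9x^4,
  so the plane \<open>x = 0\<close> is treated apart.\<close>

lemma transitive_quartic_pos_def_2:
  "positive_definite3 (transitive_quartic 1 1 1 (-1) (-1) 0)"
  unfolding positive_definite3_def
proof (intro allI impI)
  fix x y z :: real
  assume nz: "x \<noteq> 0 \<or> y \<noteq> 0 \<or> z \<noteq> 0"
  show "transitive_quartic 1 1 1 (-1) (-1) 0 x y z > 0"
  proof (cases "x = 0")
    case False
    \<comment> \<open>an \<open>LDL\<^sup>T\<close> factorisation of a rational Gram matrix of the form\<close>
    have "18 * transitive_quartic 1 1 1 (-1) (-1) 0 x y z =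
        2 * (3 * z\<^sup>2 - 6 * x * y - y\<^sup>2 + 6 * x * z + 6 * y * z - x\<^sup>2)\<^sup>2
        + 3 * (4 * x * y + 2 * y\<^sup>2 - 2 * x * z - x\<^sup>2)\<^sup>2
        + (2 * y\<^sup>2 - 6 * x * z + 6 * y * z - x\<^sup>2)\<^sup>2 + 3 * (2 * y * z + x\<^sup>2)\<^sup>2 + 9 * x^4"
      unfolding transitive_quartic_def by algebra
    also have "\<dots> > 0"
      using False by (intro add_nonneg_pos add_nonneg_nonneg) auto
    finally show ?thesis by simp
  next
    case True
    then have "transitive_quartic 1 1 1 (-1) (-1) 0 x y z =
        y^4 + z\<^sup>2 * ((z + 2 * y)\<^sup>2 + 2 * y\<^sup>2)"
      unfolding transitive_quartic_def by algebra
    also have "\<dots> > 0"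
      using nz True sq_mult_sum_squares_nonneg[of z y] sq_mult_sum_squares_pos[of z y, simplified]
      by (cases "z = 0") (auto simp: add_nonneg_pos)
    finally show ?thesis .
  qed
qed

section \<open>Criteria for arbitrary signs\<close>

lemma unit_mult: "p * q \<in> {1, -1}" if "p \<in> {1, -1}" "q \<in> {1, -1}" for p q :: real
  using that by auto

lemma trit_mult: "a * q \<in> {-1, 0, 1}" if "a \<in> {-1, 0, 1}" "q \<in> {1, -1}" for a q :: real
  using that by auto

lemma transitive_quartic_pos_def_iff:
  assumes "p \<in> {1, -1}" "q \<in> {1, -1}" "r \<in> {1, -1}"
    and "a \<in> {-1, 0, 1}" "b \<in> {-1, 0, 1}" "c \<in> {-1, 0, 1}"
  shows "positive_definite3 (transitive_quartic p q r a b c) \<longleftrightarrow>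
    a = 0 \<and> b = 0 \<and> c * p = p * q * r \<or>
    p * q * r = 1 \<and> - (a * q) = 1 \<and> - (b * r) = 1 \<and> c = 0" (is "_ \<longleftrightarrow> ?A \<or> ?B")
proof
  assume "positive_definite3 (transitive_quartic p q r a b c)"
  then have "positive_definite3 (transitive_quartic 1 1 (p * q * r) (a * q) (b * p * q) (c * p))"
    using transitive_quartic_normalise assms(1,2) by blast
  moreover have "p * q * r \<in> {1, -1}" "a * q \<in> {-1, 0, 1}" "b * p * q \<in> {-1, 0, 1}" "c * p \<in> {-1, 0, 1}"
    using assms by (simp_all only: unit_mult trit_mult)
  ultimately have "a * q = 0 \<and> b * p * q = 0 \<and> c * p = p * q * r \<or>
      p * q * r = 1 \<and> a * q = -1 \<and> b * p * q = -1 \<and> c * p = 0"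
    by (rule transitive_quartic_1_1_coeffs)
  then show "?A \<or> ?B"
    using assms(1-3) by (elim insertE emptyE; simp)
next
  assume "?A \<or> ?B"
  then show "positive_definite3 (transitive_quartic p q r a b c)"
  proof
    assume ?A
    moreover from this have "c = q * r"
      using assms(1) by auto
    ultimately show ?thesis
      using transitive_quartic_pos_def_1 assms(1-3) by simp
  next
    assume B: ?B
    \<comment> \<open>As \<open>r\<close> squares to 1, this turns the condition on
      \<open>b * r\<close> into one on the normalised coefficient.\<close>
    have "b * p * q = (p * q * r) * (b * r)"
      using assms(3) by auto
    also have "\<dots> = -1"
      using B by simp
    finally have "b * p * q = -1" .
    with B have coeffs: "p * q * r = 1" "a * q = -1" "b * p * q = -1" "c * p = 0"
      by simp_all
    show ?thesis
      by (subst transitive_quartic_normalise[OF assms(1,2)])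
         (simp only: coeffs transitive_quartic_pos_def_2)
  qed
qed

lemma cyclic_quartic_pos_def_iff:
  assumes "p \<in> {1, -1}" "q \<in> {1, -1}" "r \<in> {1, -1}"
    and "a \<in> {-1, 0, 1}" "b \<in> {-1, 0, 1}" "c \<in> {-1, 0, 1}"
  shows "positive_definite3 (cyclic_quartic p q r a b c) \<longleftrightarrow> a = 0 \<and> b = 0 \<and> c = 0"
proof
  assume "positive_definite3 (cyclic_quartic p q r a b c)"
  then have "positive_definite3 (cyclic_quartic 1 1 (p * q * r) (a * q) (b * p * q) (c * p))"
    using cyclic_quartic_normalise assms(1,2) by blast
  moreover have "p * q * r \<in> {1, -1}" "a * q \<in> {-1, 0, 1}" "b * p * q \<in> {-1, 0, 1}" "c * p \<in> {-1, 0, 1}"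
    using assms by (simp_all only: unit_mult trit_mult)
  ultimately have "a * q = 0 \<and> b * p * q = 0 \<and> c * p = 0"
    by (rule cyclic_quartic_1_1_coeffs)
  then show "a = 0 \<and> b = 0 \<and> c = 0"
    using assms(1,2) by auto
next
  assume "a = 0 \<and> b = 0 \<and> c = 0"
  then show "positive_definite3 (cyclic_quartic p q r a b c)"
    using cyclic_quartic_pos_def assms(1-3) by simp
qed

section \<open>Symmetric tensors of order four\<close>

text \<open>Adjacent transpositions generate all permutations of the slots; used as rewrite rules,
  they bring equal entries to a common form.\<close>

lemma symmetric_tensor4_swaps:
  assumes "symmetric_tensor4 T"
  shows "T b a c d = T a b c d" "T a c b d = T a b c d" "T a b d c = T a b c d"
proof -
  define f where "f n = (if n = 1 then a else if n = 2 then b else if n = 3 then c else d)" for n :: nat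
  have sym: "T (f (\<sigma> 1)) (f (\<sigma> 2)) (f (\<sigma> 3)) (f (\<sigma> 4)) = T (f 1) (f 2) (f 3) (f 4)"
    if "\<sigma> permutes {1..4}" for \<sigma>
    using assms that unfolding symmetric_tensor4_def by blast
  show "T b a c d = T a b c d"
    using sym[OF permutes_swap_id[of 1 _ 2]] by (simp add: f_def transpose_def)
  show "T a c b d = T a b c d"
    using sym[OF permutes_swap_id[of 2 _ 3]] by (simp add: f_def transpose_def)
  show "T a b d c = T a b c d"
    using sym[OF permutes_swap_id[of 3 _ 4]] by (simp add: f_def transpose_def)
qed

lemma UNIV_3_distinct:
  fixes i j k :: 3
  assumes "i \<noteq> j" "j \<noteq> k" "i \<noteq> k"
  shows "UNIV = {i, j, k}"
  using assms exhaust_3[of i] exhaust_3[of j] exhaust_3[of k] by (auto simp: UNIV_3)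

lemma mset_eq_123_iff:
  fixes i j k :: 3
  shows "mset [i, j, k] = mset [1, 2, 3] \<longleftrightarrow> i \<noteq> j \<and> j \<noteq> k \<and> i \<noteq> k"
proof
  assume "mset [i, j, k] = mset [1, 2, 3]"
  from mset_eq_imp_distinct_iff[OF this] show "i \<noteq> j \<and> j \<noteq> k \<and> i \<noteq> k"
    by simp
next
  assume "i \<noteq> j \<and> j \<noteq> k \<and> i \<noteq> k"
  then show "mset [i, j, k] = mset [1, 2, 3]"
    using exhaust_3[of i] exhaust_3[of j] exhaust_3[of k] by (auto simp: add_mset_commute)
qed

text \<open>The factors 4, 6 and 12 count the arrangements of each index multiset. Allowing any
  labelling i, j, k avoids relabelling arguments later.\<close>

lemma tensor4_form_3:
  fixes T :: "3 tensor4"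
  assumes sym: "symmetric_tensor4 T" and ne: "i \<noteq> j" "j \<noteq> k" "i \<noteq> k"
  shows "tensor4_form T v =
    T i i i i * (v$i)^4 + T j j j j * (v$j)^4 + T k k k k * (v$k)^4
    + 4 * (T i i i j * (v$i)^3 * v$j + T i j j j * v$i * (v$j)^3
         + T j j j k * (v$j)^3 * v$k + T j k k k * v$j * (v$k)^3
         + T i i i k * (v$i)^3 * v$k + T i k k k * v$i * (v$k)^3)
    + 6 * (T i i j j * (v$i)^2 * (v$j)^2 + T i i k k * (v$i)^2 * (v$k)^2 + T j j k k * (v$j)^2 * (v$k)^2)
    + 12 * (T i i j k * (v$i)^2 * v$j * v$k + T i j j k * v$i * (v$j)^2 * v$k
          + T i j k k * v$i * v$j * (v$k)^2)"
  unfolding tensor4_form_def UNIV_3_distinct[OF ne]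
  using ne by (simp add: symmetric_tensor4_swaps[OF sym] algebra_simps power2_eq_square power3_eq_cube power4_eq_xxxx)

lemma positive_definite_tensor4_iff:
  fixes T :: "3 tensor4"
  assumes ne: "i \<noteq> j" "j \<noteq> k" "i \<noteq> k" and form: "\<And>v. tensor4_form T v = f (v$i) (v$j) (v$k)"
  shows "positive_definite_tensor4 T \<longleftrightarrow> positive_definite3 f"
proof -
  have zero: "v = 0 \<longleftrightarrow> v$i = 0 \<and> v$j = 0 \<and> v$k = 0" for v :: "real^3"
  proof -
    have "v = 0 \<longleftrightarrow> (\<forall>m\<in>{i, j, k}. v$m = 0)"
      by (simp add: vec_eq_iff flip: UNIV_3_distinct[OF ne])
    then show ?thesis by simp
  qed
  show ?thesis
  proof
    assume pd: "positive_definite_tensor4 T"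
    show "positive_definite3 f"
      unfolding positive_definite3_def
    proof (intro allI impI)
      fix x y z :: real
      assume nz: "x \<noteq> 0 \<or> y \<noteq> 0 \<or> z \<noteq> 0"
      define v :: "real^3" where "v = (\<chi> m. if m = i then x else if m = j then y else z)"
      have "v$i = x" "v$j = y" "v$k = z"
        using ne by (auto simp: v_def)
      with nz pd show "f x y z > 0"
        using form[of v] zero[of v] unfolding positive_definite_tensor4_def by metis
    qed
  next
    assume "positive_definite3 f"
    then show "positive_definite_tensor4 T"
      unfolding positive_definite_tensor4_def positive_definite3_def form using zero by blast
  qed
qed

section \<open>Tensors with tournament-like cubic coefficients\<close>

locale tournament_tensor =
  fixes t :: "3 tensor4"
  assumes mem: "t \<in> E_hat_4_3"
    and cubic: "\<And>i j. i \<noteq> j \<Longrightarrow> t i i i j * t i j j j = 0 \<and> t i i i j + t i j j j \<noteq> 0"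
begin

lemma sym: "symmetric_tensor4 t"
  using mem by (simp add: E_hat_4_3_def)

lemmas swaps = symmetric_tensor4_swaps[OF sym]

lemma entries: "t i j k l \<in> {-1, 0, 1}"
  using mem unfolding E_hat_4_3_def by blast

lemma diag: "t i i i i = 1"
  using mem exhaust_3[of i] unfolding E_hat_4_3_def by auto

lemma cubic_cases:
  assumes "i \<noteq> j"
  shows "t i i i j = 0 \<and> t i j j j \<in> {1, -1} \<or> t i j j j = 0 \<and> t i i i j \<in> {1, -1}"
  using cubic[OF assms] entries[of i i i j] entries[of i j j j] by auto

lemma square_coeff:
  assumes pd: "positive_definite_tensor4 t" and ij: "i \<noteq> j"
  shows "t i i j j = 1"
proof -
  have "card {i, j} < CARD(3)"
    using ij by simp
  then obtain k where "k \<notin> {i, j}"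
    by (metis UNIV_eq_I less_irrefl)
  then have ne: "i \<noteq> j" "j \<noteq> k" "i \<noteq> k"
    using ij by auto
  \<comment> \<open>One of the two summands is 0 and the other is a sign. At e_i - s e_j the cubic
    terms therefore contribute -4, leaving 6 t_iijj - 2, which is positive only for t_iijj =
    1.\<close>
  define s where "s = t i i i j + t i j j j"
  have s: "s * s = 1"
    using cubic_cases[OF ij] by (auto simp: s_def)
  define v :: "real^3" where "v = (\<chi> m. if m = i then 1 else if m = j then - s else 0)"
  have v: "v$i = 1" "v$j = - s" "v$k = 0"
    using ne by (auto simp: v_def)
  have "0 < tensor4_form t v"
    using pd v(1) unfolding positive_definite_tensor4_def by (metis zero_index zero_neq_one)
  also have "\<dots> = 6 * t i i j j - 2"
    unfolding tensor4_form_3[OF sym ne] v diag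
    using s by (simp add: s_def) algebra
  finally show ?thesis
    using entries[of i i j j] by auto
qed

lemma transitive_form:
  assumes "i \<noteq> j" "j \<noteq> k" "i \<noteq> k" "\<forall>i j. i \<noteq> j \<longrightarrow> t i i j j = 1"
    and "t i i i j = 0" "t j j j k = 0" "t i i i k = 0"
  shows "positive_definite_tensor4 t \<longleftrightarrow> positive_definite3
    (transitive_quartic (t i j j j) (t j k k k) (t i k k k) (t i i j k) (t i j j k) (t i j k k))"
  using assms
  by (intro positive_definite_tensor4_iff[of i j k])
     (simp_all add: tensor4_form_3[OF sym, of i j k] transitive_quartic_def diag)

lemma cyclic_form:
  assumes "i \<noteq> j" "j \<noteq> k" "i \<noteq> k" "\<forall>i j. i \<noteq> j \<longrightarrow> t i i j j = 1"
    and "t i i i j = 0" "t j j j k = 0" "t i k k k = 0"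
  shows "positive_definite_tensor4 t \<longleftrightarrow> positive_definite3
    (cyclic_quartic (t i j j j) (t j k k k) (t i i i k) (t i i j k) (t i j j k) (t i j k k))"
  using assms
  by (intro positive_definite_tensor4_iff[of i j k])
     (simp_all add: tensor4_form_3[OF sym, of i j k] cyclic_quartic_def diag)

lemma transitive_pos_def_iff:
  assumes ne: "i \<noteq> j" "j \<noteq> k" "i \<noteq> k" and sq: "\<forall>i j. i \<noteq> j \<longrightarrow> t i i j j = 1"
    and z: "t i i i j = 0" "t j j j k = 0" "t i i i k = 0"
  shows "positive_definite_tensor4 t \<longleftrightarrow>
    t i i j k = 0 \<and> t i j j k = 0 \<and> t i j k k * t i j j j = t i j j j * t j k k k * t i k k k \<or>
    t i j j j * t j k k k * t i k k k = 1 \<and>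
    - (t i i j k * t j k k k) = 1 \<and> - (t i j j k * t i k k k) = 1 \<and> t i j k k = 0"
proof -
  have "t i j j j \<in> {1, -1}" "t j k k k \<in> {1, -1}" "t i k k k \<in> {1, -1}"
    using cubic_cases[OF ne(1)] cubic_cases[OF ne(2)] cubic_cases[OF ne(3)] z by auto
  from transitive_quartic_pos_def_iff[OF this entries[of i i j k] entries[of i j j k] entries[of i j k k]] show ?thesis
    unfolding transitive_form[OF ne sq z] .
qed

lemma cyclic_pos_def_iff:
  assumes ne: "i \<noteq> j" "j \<noteq> k" "i \<noteq> k" and sq: "\<forall>i j. i \<noteq> j \<longrightarrow> t i i j j = 1"
    and z: "t i i i j = 0" "t j j j k = 0" "t i k k k = 0"
  shows "positive_definite_tensor4 t \<longleftrightarrow> t 1 1 2 3 = 0 \<and> t 1 2 2 3 = 0 \<and> t 1 2 3 3 = 0"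
proof -
  have "t i j j j \<in> {1, -1}" "t j k k k \<in> {1, -1}" "t i i i k \<in> {1, -1}"
    using cubic_cases[OF ne(1)] cubic_cases[OF ne(2)] cubic_cases[OF ne(3)] z by auto
  from cyclic_quartic_pos_def_iff[OF this entries[of i i j k] entries[of i j j k] entries[of i j k k]]
  have "positive_definite_tensor4 t \<longleftrightarrow> t i i j k = 0 \<and> t i j j k = 0 \<and> t i j k k = 0"
    unfolding cyclic_form[OF ne sq z] .
  \<comment> \<open>The entries t_iijk, t_ijjk, t_ijkk are t_1123, t_1223, t_1233 in some order, so
    their joint vanishing does not depend on the labelling.\<close>
  also have "\<dots> \<longleftrightarrow> t 1 1 2 3 = 0 \<and> t 1 2 2 3 = 0 \<and> t 1 2 3 3 = 0"
    using ne exhaust_3[of i] exhaust_3[of j] exhaust_3[of k] by (auto simp: swaps)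
  finally show ?thesis .
qed

text \<open>Every tournament on three vertices has a Hamiltonian path.\<close>

lemma ex_path:
  obtains i j k :: 3 where "i \<noteq> j" "j \<noteq> k" "i \<noteq> k" "t i i i j = 0" "t j j j k = 0"
proof -
  have arrow: "t i i i j = 0 \<or> t j j j i = 0" if "i \<noteq> j" for i j
    using cubic_cases[OF that] swaps by metis
  have "(1::3) \<noteq> 2" "(2::3) \<noteq> 3" "(1::3) \<noteq> 3"
    by simp_all
  then show thesis
    using arrow[of 1 2] arrow[of 2 3] arrow[of 1 3] that by metis
qed

end

theorem theorem3p4:
  fixes t :: "3 tensor4"
  assumes "t \<in> E_hat_4_3"
    and "\<And>i j. i \<noteq> j \<Longrightarrow> t i i i j * t i j j j = 0 \<and> t i i i j + t i j j j \<noteq> 0"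
  shows "positive_definite_tensor4 t \<longleftrightarrow>
    (\<forall>i j. i \<noteq> j \<longrightarrow> t i i j j = 1) \<and>
    (\<exists>i j k. mset [i, j, k] = mset [1, 2, 3] \<and>
      ((t 1 1 2 3 = 0 \<and> t 1 2 2 3 = 0 \<and> t 1 2 3 3 = 0 \<and>
        t i i i j = 0 \<and> t j j j k = 0 \<and> t i k k k = 0 \<and>
        t i j j j \<in> {1, -1} \<and> t j k k k \<in> {1, -1} \<and> t i i i k \<in> {1, -1})
      \<or>
       (t i i i j = 0 \<and> t j j j k = 0 \<and> t i i i k = 0 \<and>
        ((t i i j k = 0 \<and> t i j j k = 0 \<and>
          t i j k k * t i j j j = t i j j j * t j k k k * t i k k k \<and>
          t i j j j * t j k k k * t i k k k \<in> {1, -1})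
        \<or>
         (t i j j j * t j k k k * t i k k k = 1 \<and>
          - (t i i j k * t j k k k) = 1 \<and> - (t i j j k * t i k k k) = 1 \<and>
          t i j k k = 0)))))"
  (is "_ \<longleftrightarrow> ?sq \<and> (\<exists>i j k. ?perm i j k \<and> (?a i j k \<or> ?b i j k))")
proof -
  interpret tournament_tensor t
    using assms by unfold_locales
  show ?thesis
  proof (intro iffI conjI; (elim conjE exE)?)
    assume pd: "positive_definite_tensor4 t"
    show sq: ?sq
      using square_coeff[OF pd] by blast
    obtain i j k where ne: "i \<noteq> j" "j \<noteq> k" "i \<noteq> k" and z: "t i i i j = 0" "t j j j k = 0"
      by (rule ex_path)
    have units: "t i j j j \<in> {1, -1}" "t j k k k \<in> {1, -1}"
      using cubic_cases[OF ne(1)] cubic_cases[OF ne(2)] z by auto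
    \<comment> \<open>The edge joining the ends of the path decides between the transitive case,
      giving (b), and the cyclic case, giving (a).\<close>
    from cubic_cases[OF ne(3)] have "?a i j k \<or> ?b i j k"
    proof
      assume ik: "t i i i k = 0 \<and> t i k k k \<in> {1, -1}"
      then have "t i j j j * t j k k k * t i k k k \<in> {1, -1}"
        using units by auto
      then show ?thesis
        using transitive_pos_def_iff[OF ne sq z] ik z pd by blast
    next
      assume "t i k k k = 0 \<and> t i i i k \<in> {1, -1}"
      then show ?thesis
        using cyclic_pos_def_iff[OF ne sq z] units z pd by blast
    qed
    then show "\<exists>i j k. ?perm i j k \<and> (?a i j k \<or> ?b i j k)"
      using ne mset_eq_123_iff by blast
  next
    fix i j k
    assume sq: ?sq and perm: "?perm i j k" and ab: "?a i j k \<or> ?b i j k"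
    from perm have ne: "i \<noteq> j" "j \<noteq> k" "i \<noteq> k"
      unfolding mset_eq_123_iff by blast+
    from ab show "positive_definite_tensor4 t"
    proof
      assume "?a i j k"
      then show ?thesis
        using cyclic_pos_def_iff[OF ne sq] by blast
    next
      assume "?b i j k"
      then show ?thesis
        using transitive_pos_def_iff[OF ne sq] by blast
    qed
  qed
qed

end
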